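(* Let $G$ be a finite Abelian group of exponent $n$ and let $\mathcal{D}_n=\{d_1,\dots,d_m\}$ be the set of positive divisors of $n$. Let $S$ be a sequence over $G$ containing no tiny zero-sum subsequence, with $\mathsf{k}(S)=\rho(G)$, and of minimal length among all sequences over $G$ with these two properties. For $d\in\mathcal{D}_n$ let $x_d=|S_d|$. Then the $m$-tuple $x=(x_{d_1},\dots,x_{d_m})\in\mathbb{N}^m$ satisfies, for every $d\in\mathcal{D}_n$ and every divisor $d'>1$ of $d$, $$x_d \leq \eta_{(d',d)}(G)-1.$$ Equivalently, $x$ lies in the set $\mathbb{P}_G=\{x\in\mathbb{N}^m : f_d(x)\geq 0 \text{ for all } d\in\mathcal{D}_n\}$ where $f_d(x)=\min_{d'\in\mathcal{D}_d\setminus\{1\}}\left(\eta_{(d',d)}(G)-1-x_d\right)$.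
   Context: $G$ is written additively; $\exp(G)$ is its exponent; for $m\mid\exp(G)$, $G_m=\{x\in G: mx=0\}$. A sequence over $G$ (or over a subset) is a finite multiset of elements; subsequences are sub-multisets; $|S|$ is the length and $\sigma(S)$ the sum. The cross number is $\mathsf{k}(S)=\sum_{g\in S}1/\mathrm{ord}(g)$ (with multiplicity). A tiny zero-sum subsequence of $S$ is a non-empty subsequence $S'$ with $\sigma(S')=0$ and $\mathsf{k}(S')\leq1$. $\rho(G)=\max\{\mathsf{k}(S): S \text{ a sequence over } G \text{ containing no tiny zero-sum subsequence}\}$. For $d\mid\exp(G)$, $S_d$ is the subsequence of $S$ consisting of all its elements of order exactly $d$. For $d'\mid d\mid\exp(G)$, $\eta_{(d',d)}(G)$ is the smallest positive integer $t$ such that every sequence over $G_d$ of length at least $t$ contains a non-empty subsequence of length at most $d'$ with sum in $G_{d/d'}$. $\mathcal{D}_d$ denotes the set of positive divisors of $d$. *)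

theory Defs
  imports "HOL-Algebra.Multiplicative_Group" "HOL-Library.Multiset" "HOL-Library.Extended_Real"
begin

text \<open>
  Abelian groups are the multiplicatively written commutative groups of HOL-Algebra, so
  the multiple \<open>m x\<close> of the additive notation is \<open>x [^] m\<close>, and \<open>0\<close> is \<open>\<one>\<close>.
  A sequence over a subset \<open>A\<close> of the group is a multiset \<open>S\<close> with \<open>set_mset S \<subseteq> A\<close>.
\<close>

definition group_exp :: "('a, 'b) monoid_scheme \<Rightarrow> nat" where
  "group_exp G = (LEAST n. 0 < n \<and> (\<forall>x\<in>carrier G. x [^]\<^bsub>G\<^esub> n = \<one>\<^bsub>G\<^esub>))"

definition torsion :: "('a, 'b) monoid_scheme \<Rightarrow> nat \<Rightarrow> 'a set" where
  "torsion G m = {x \<in> carrier G. x [^]\<^bsub>G\<^esub> m = \<one>\<^bsub>G\<^esub>}"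

definition seq_sum :: "('a, 'b) monoid_scheme \<Rightarrow> 'a multiset \<Rightarrow> 'a" where
  "seq_sum G S = (\<Otimes>\<^bsub>G\<^esub>g\<in>set_mset S. g [^]\<^bsub>G\<^esub> count S g)"

definition cross_number :: "('a, 'b) monoid_scheme \<Rightarrow> 'a multiset \<Rightarrow> real" where
  "cross_number G S = (\<Sum>g\<in>#S. 1 / real (group.ord G g))"

definition tiny_zero_sum :: "('a, 'b) monoid_scheme \<Rightarrow> 'a multiset \<Rightarrow> bool" where
  "tiny_zero_sum G T \<longleftrightarrow> T \<noteq> {#} \<and> seq_sum G T = \<one>\<^bsub>G\<^esub> \<and> cross_number G T \<le> 1"

definition tiny_free :: "('a, 'b) monoid_scheme \<Rightarrow> 'a multiset \<Rightarrow> bool" where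
  "tiny_free G S \<longleftrightarrow> \<not> (\<exists>T. T \<subseteq># S \<and> tiny_zero_sum G T)"

definition rho :: "('a, 'b) monoid_scheme \<Rightarrow> real" where
  "rho G = Max {cross_number G S | S. set_mset S \<subseteq> carrier G \<and> tiny_free G S}"

definition order_part :: "('a, 'b) monoid_scheme \<Rightarrow> 'a multiset \<Rightarrow> nat \<Rightarrow> 'a multiset" where
  "order_part G S d = {#g \<in># S. group.ord G g = d#}"

definition eta :: "('a, 'b) monoid_scheme \<Rightarrow> nat \<Rightarrow> nat \<Rightarrow> nat" where
  "eta G d' d = (LEAST t. 0 < t \<and>
     (\<forall>S. set_mset S \<subseteq> torsion G d \<and> t \<le> size S \<longrightarrow>
       (\<exists>T. T \<subseteq># S \<and> T \<noteq> {#} \<and> size T \<le> d' \<and> seq_sum G T \<in> torsion G (d div d'))))"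

text \<open>
  The values are extended reals because for \<open>d = 1\<close> the minimum ranges over the empty set;
  it is then \<open>\<infinity>\<close>, so that \<open>d = 1\<close> imposes no condition. For \<open>d > 1\<close> the infimum is a
  minimum, see \<open>constraint_eq_Min\<close>.
\<close>

definition constraint :: "('a, 'b) monoid_scheme \<Rightarrow> nat \<Rightarrow> (nat \<Rightarrow> nat) \<Rightarrow> ereal" where
  "constraint G d x =
     (INF d'\<in>{d'. d' dvd d} - {1}. ereal (real (eta G d' d) - 1 - real (x d)))"

text \<open>Tuples indexed by the divisors of the exponent are extensional functions on that set.\<close>

definition constraint_set :: "('a, 'b) monoid_scheme \<Rightarrow> (nat \<Rightarrow> nat) set" where
  "constraint_set G = {x \<in> {d. d dvd group_exp G} \<rightarrow>\<^sub>E UNIV.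
     \<forall>d. d dvd group_exp G \<longrightarrow> 0 \<le> constraint G d x}"

lemma constraint_eq_Min:
  assumes "1 < d"
  shows "constraint G d x =
    ereal (Min ((\<lambda>d'. real (eta G d' d) - 1 - real (x d)) ` ({d'. d' dvd d} - {1})))"
proof -
  let ?A = "{d'. d' dvd d} - {1}" and ?f = "\<lambda>d'. real (eta G d' d) - 1 - real (x d)"
  have fin: "finite ?A" using assms by auto
  have "d \<in> ?A" using assms by simp
  then have ne: "?A \<noteq> {}" by blast
  have "Min (?f ` ?A) \<in> ?f ` ?A" using fin ne by (intro Min_in) auto
  then obtain a where a: "a \<in> ?A" "Min (?f ` ?A) = ?f a" by auto
  have "?f a \<le> ?f b" if "b \<in> ?A" for b
    unfolding a(2)[symmetric] using fin that by (intro Min_le) auto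
  then have "(INF d'\<in>?A. ereal (?f d')) = ereal (?f a)"
    using a(1) by (intro antisym INF_lower INF_greatest) auto
  then show ?thesis unfolding constraint_def a(2) .
qed

end

theory Submission
  imports Defs
begin

text \<open>
  If \<open>S\<close> had \<open>\<eta>\<close> elements of order \<open>d\<close>, some subsequence \<open>T\<close> of them, of length at most \<open>d'\<close>,
  would have its sum \<open>g\<close> in \<open>G\<^sub>d\<^sub>/\<^sub>d\<^sub>'\<close>, so that \<open>k(T) \<le> d'/d \<le> 1/ord(g)\<close>. Replacing \<open>T\<close> by \<open>g\<close>
  therefore does not decrease the cross number, and it creates no tiny zero-sum
  subsequence, since expanding \<open>g\<close> back into \<open>T\<close> would give one of \<open>S\<close>. As \<open>k(S)\<close> is maximal and
  \<open>S\<close> is as short as possible, \<open>T\<close> is the single element \<open>g\<close>, whose order \<open>d\<close> cannot divide \<open>d/d'\<close>.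
\<close>

section \<open>Sums of sequences\<close>

context comm_monoid
begin

text \<open>Elements of \<open>A\<close> outside \<open>S\<close> contribute
  \<open>g [^] 0 = \<one>\<close>. Enlarging the index set puts two sequences with different
  supports over a common one, which additivity of the sum needs.\<close>

lemma seq_sum_superset:
  assumes "finite A" "set_mset S \<subseteq> A" "A \<subseteq> carrier G"
  shows "seq_sum G S = (\<Otimes>g\<in>A. g [^] count S g)"
  unfolding seq_sum_def
  using assms by (intro finprod_mono_neutral_cong_left) (auto simp: not_in_iff)

lemma seq_sum_closed [simp, intro]:
  "set_mset S \<subseteq> carrier G \<Longrightarrow> seq_sum G S \<in> carrier G"
  unfolding seq_sum_def by (intro finprod_closed) auto

lemma seq_sum_union:
  assumes "set_mset S \<subseteq> carrier G" "set_mset T \<subseteq> carrier G"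
  shows "seq_sum G (S + T) = seq_sum G S \<otimes> seq_sum G T"
proof -
  let ?A = "set_mset S \<union> set_mset T"
  have A: "finite ?A" "?A \<subseteq> carrier G"
    using assms by auto
  have "seq_sum G (S + T) = (\<Otimes>g\<in>?A. g [^] count (S + T) g)"
    using A by (intro seq_sum_superset) auto
  also have "\<dots> = (\<Otimes>g\<in>?A. g [^] count S g \<otimes> g [^] count T g)"
    using assms by (intro finprod_cong') (auto simp: nat_pow_mult subset_iff)
  also have "\<dots> = (\<Otimes>g\<in>?A. g [^] count S g) \<otimes> (\<Otimes>g\<in>?A. g [^] count T g)"
    using A by (intro finprod_multf) auto
  also have "\<dots> = seq_sum G S \<otimes> seq_sum G T"
    using A by (simp add: seq_sum_superset[of ?A])
  finally show ?thesis .
qed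

lemma seq_sum_replicate:
  assumes "g \<in> carrier G"
  shows "seq_sum G (replicate_mset k g) = g [^] k"
  using assms by (subst seq_sum_superset[of "{g}"]) auto

lemma seq_sum_single: "g \<in> carrier G \<Longrightarrow> seq_sum G {#g#} = g"
  using seq_sum_replicate[of g 1] by simp

end

section \<open>Cross numbers\<close>

lemma cross_number_union: "cross_number G (S + T) = cross_number G S + cross_number G T"
  by (simp add: cross_number_def)

lemma cross_number_single: "cross_number G {#g#} = 1 / real (group.ord G g)"
  by (simp add: cross_number_def)

lemma cross_number_replicate:
  "cross_number G (replicate_mset k g) = real k / real (group.ord G g)"
  by (induction k) (simp_all add: cross_number_def add_divide_distrib)

lemma cross_number_const_ord:
  assumes "\<And>g. g \<in># T \<Longrightarrow> group.ord G g = d"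
  shows "cross_number G T = real (size T) / real d"
  using assms by (induction T) (simp_all add: cross_number_def add_divide_distrib)

section \<open>Finiteness and counting for multisets\<close>

lemma subset_mset_add_mset_notin:
  assumes "a \<notin># T" "T \<subseteq># add_mset a S"
  shows "T \<subseteq># S"
proof (rule mset_subset_eqI)
  fix b
  show "count T b \<le> count S b"
    using assms mset_subset_eq_count[OF assms(2), of b]
    by (cases "a = b") (auto simp: not_in_iff)
qed

lemma finite_submultisets: "finite {T. T \<subseteq># S}"
proof (induction S)
  case empty
  show ?case by simp
next
  case (add a S)
  have "{T. T \<subseteq># add_mset a S} \<subseteq> {T. T \<subseteq># S} \<union> add_mset a ` {T. T \<subseteq># S}"
  proof
    fix T assume "T \<in> {T. T \<subseteq># add_mset a S}"
    then have T: "T \<subseteq># add_mset a S" by simp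
    show "T \<in> {T. T \<subseteq># S} \<union> add_mset a ` {T. T \<subseteq># S}"
    proof (cases "a \<in># T")
      case True
      then obtain U where "T = add_mset a U" by (metis insert_DiffM)
      then show ?thesis using T by auto
    next
      case False
      then have "T \<subseteq># S"
        using T by (simp add: subset_mset_add_mset_notin)
      then show ?thesis by simp
    qed
  qed
  moreover have "finite ({T. T \<subseteq># S} \<union> add_mset a ` {T. T \<subseteq># S})"
    using add by simp
  ultimately show ?case by (rule finite_subset)
qed

lemma count_bound_subset_sum:
  assumes "finite A" "set_mset S \<subseteq> A" "\<And>g. g \<in> A \<Longrightarrow> count S g \<le> b g"
  shows "S \<subseteq># (\<Sum>g\<in>A. replicate_mset (b g) g)"
proof (rule mset_subset_eqI)
  fix g
  show "count S g \<le> count (\<Sum>g\<in>A. replicate_mset (b g) g) g"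
    using assms by (cases "g \<in> A") (auto simp: count_sum sum.delta not_in_iff)
qed

text \<open>A pigeonhole principle, used in contrapositive form: a long sequence over a finite set
  repeats some element often.\<close>

lemma size_le_card_mult:
  assumes "finite A" "set_mset S \<subseteq> A" "\<And>g. g \<in> A \<Longrightarrow> count S g \<le> b"
  shows "size S \<le> card A * b"
proof -
  have "size S = (\<Sum>g\<in>set_mset S. count S g)"
    by (rule size_multiset_overloaded_eq)
  also have "\<dots> \<le> (\<Sum>g\<in>A. count S g)"
    using assms by (intro sum_mono2) auto
  also have "\<dots> \<le> card A * b"
    using assms(3) sum_bounded_above[of A "count S" b] by simp
  finally show ?thesis .
qed

lemma tiny_freeD:
  "\<lbrakk>tiny_free G S; T \<subseteq># S; T \<noteq> {#}; seq_sum G T = \<one>\<^bsub>G\<^esub>\<rbrakk> \<Longrightarrow> 1 < cross_number G T"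
  unfolding tiny_free_def tiny_zero_sum_def by force

section \<open>Existence of the extrema defining \<open>rho\<close> and \<open>eta\<close>\<close>

locale finite_comm_group = comm_group +
  assumes fin: "finite (carrier G)"
begin

text \<open>The group order is an admissible exponent, so the \<open>LEAST\<close> is attained.
  Positivity makes every divisor of the exponent positive.\<close>

lemma group_exp_pos: "0 < group_exp G"
proof -
  have "0 < order G \<and> (\<forall>x\<in>carrier G. x [^] order G = \<one>)"
    using fin pow_order_eq_1 order_gt_0_iff_finite by auto
  from LeastI[of "\<lambda>n. 0 < n \<and> (\<forall>x\<in>carrier G. x [^] n = \<one>)", OF this]
  show ?thesis unfolding group_exp_def by blast
qed

text \<open>The sequence of \<open>ord g\<close> copies of \<open>g\<close> has sum zero and cross
  number exactly 1, so it is tiny.\<close>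

lemma tiny_free_count_less_ord:
  assumes "tiny_free G S" "g \<in> carrier G"
  shows "count S g < ord g"
proof (rule ccontr)
  assume "\<not> count S g < ord g"
  then have "replicate_mset (ord g) g \<subseteq># S"
    using count_le_replicate_mset_subset_eq not_less by metis
  moreover have "0 < ord g"
    using ord_ge_1[OF fin assms(2)] by simp
  moreover have "seq_sum G (replicate_mset (ord g) g) = \<one>"
    using assms(2) by (simp add: seq_sum_replicate)
  ultimately show False
    using tiny_freeD[OF assms(1), of "replicate_mset (ord g) g"]
    by (simp add: cross_number_replicate)
qed

text \<open>\<open>Max\<close> bounds its set only if that set is finite. Multiplicities in a
  tiny-free sequence stay below the orders, so all such sequences are submultisets of one fixed
  multiset.\<close>

lemma cross_number_le_rho:
  assumes "set_mset S \<subseteq> carrier G" "tiny_free G S"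
  shows "cross_number G S \<le> rho G"
proof -
  let ?F = "{S. set_mset S \<subseteq> carrier G \<and> tiny_free G S}"
  have "?F \<subseteq> {T. T \<subseteq># (\<Sum>g\<in>carrier G. replicate_mset (ord g) g)}"
    using count_bound_subset_sum[OF fin] tiny_free_count_less_ord less_imp_le by blast
  then have "finite ?F"
    using finite_submultisets finite_subset by blast
  then have "finite (cross_number G ` ?F)" by simp
  then show ?thesis
    unfolding rho_def setcompr_eq_image using assms by (intro Max_ge) auto
qed

text \<open>The defining property of \<open>eta\<close>, a \<open>LEAST\<close>, can be used once
  some length is shown to have it.\<close>

lemma etaD:
  assumes "0 < d'" "d' dvd d" "set_mset S \<subseteq> torsion G d" "eta G d' d \<le> size S"
  obtains T where "T \<subseteq># S" "T \<noteq> {#}" "size T \<le> d'" "seq_sum G T \<in> torsion G (d div d')"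
proof -
  let ?Q = "\<lambda>S. \<exists>T. T \<subseteq># S \<and> T \<noteq> {#} \<and> size T \<le> d' \<and> seq_sum G T \<in> torsion G (d div d')"
  let ?P = "\<lambda>t. 0 < t \<and> (\<forall>S. set_mset S \<subseteq> torsion G d \<and> t \<le> size S \<longrightarrow> ?Q S)"
  \<comment> \<open>At this length some \<open>g\<close> occurs more than \<open>d'\<close> times.
    The sum of \<open>d'\<close> copies of \<open>g\<close> is killed by \<open>d div d'\<close>,
    because \<open>g\<close> is killed by \<open>d\<close>.\<close>
  have "?Q S" if S: "set_mset S \<subseteq> torsion G d" and large: "card (carrier G) * d' + 1 \<le> size S" for S
  proof -
    have "set_mset S \<subseteq> carrier G"
      using S by (auto simp: torsion_def)
    then obtain g where g: "g \<in> carrier G" "d' < count S g"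
      using size_le_card_mult[OF fin, of S d'] large by fastforce
    then have "g \<in># S"
      by (simp flip: count_greater_zero_iff)
    then have "g \<in> torsion G d"
      using S by blast
    then have "(g [^] d') [^] (d div d') = \<one>"
      using assms(2) by (simp add: torsion_def nat_pow_pow)
    moreover have "replicate_mset d' g \<subseteq># S"
      using g(2) count_le_replicate_mset_subset_eq less_imp_le by metis
    ultimately show ?thesis
      using g(1) assms(1)
      by (intro exI[of _ "replicate_mset d' g"]) (auto simp: seq_sum_replicate torsion_def)
  qed
  then have "?P (card (carrier G) * d' + 1)" by simp
  then have "?P (eta G d' d)" unfolding eta_def by (rule LeastI)
  with assms(3,4) show thesis using that by blast
qed

section \<open>Replacing a subsequence by its sum\<close>

text \<open>A tiny zero-sum subsequence through the new element expands to one of \<open>S\<close>: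
  the sum is unchanged, and the bound on the cross number of \<open>T\<close> keeps the total at
  most 1.\<close>

lemma tiny_free_contract:
  assumes "set_mset S \<subseteq> carrier G" "tiny_free G S" "T \<subseteq># S" "T \<noteq> {#}"
    and "cross_number G T \<le> 1 / real (ord (seq_sum G T))"
  shows "tiny_free G (add_mset (seq_sum G T) (S - T))"
proof (rule ccontr)
  let ?g = "seq_sum G T"
  assume "\<not> tiny_free G (add_mset ?g (S - T))"
  then obtain U where U: "U \<subseteq># add_mset ?g (S - T)" "U \<noteq> {#}" "seq_sum G U = \<one>"
      "cross_number G U \<le> 1"
    by (auto simp: tiny_free_def tiny_zero_sum_def)
  have T: "set_mset T \<subseteq> carrier G"
    using assms(1,3) set_mset_mono by blast
  then have g: "?g \<in> carrier G" by simp
  show False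
  proof (cases "?g \<in># U")
    case False
    then have "U \<subseteq># S - T"
      using U(1) by (simp add: subset_mset_add_mset_notin)
    then have "U \<subseteq># S"
      by (meson diff_subset_eq_self subset_mset.order_trans)
    then show False
      using tiny_freeD[OF assms(2) _ U(2,3)] U(4) by simp
  next
    case True
    \<comment> \<open>Only one copy of the sum is expanded. Further copies in \<open>V\<close>
      already belong to \<open>S - T\<close>.\<close>
    then obtain V where V: "U = add_mset ?g V" by (metis insert_DiffM)
    then have "V \<subseteq># S - T" using U(1) by simp
    then have sub: "V + T \<subseteq># S"
      using assms(3) by (metis subset_mset.le_diff_conv2)
    then have Vc: "set_mset V \<subseteq> carrier G"
      using assms(1) set_mset_mono by fastforce
    have "seq_sum G U = ?g \<otimes> seq_sum G V"
      using seq_sum_union[of "{#?g#}" V] Vc g V by (simp add: seq_sum_single)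
    then have "seq_sum G (V + T) = \<one>"
      using U(3) Vc T by (simp add: seq_sum_union m_comm)
    moreover have "cross_number G U = 1 / real (ord ?g) + cross_number G V"
      using cross_number_union[of G "{#?g#}" V] V by (simp add: cross_number_single)
    then have "cross_number G (V + T) \<le> 1"
      using U(4) assms(5) by (simp add: cross_number_union)
    ultimately show False
      using tiny_freeD[OF assms(2) sub] assms(4) by simp
  qed
qed

lemma order_part_less_eta:
  assumes S: "set_mset S \<subseteq> carrier G" "tiny_free G S" "cross_number G S = rho G"
    and minimal: "\<And>T. \<lbrakk>set_mset T \<subseteq> carrier G; tiny_free G T; cross_number G T = rho G\<rbrakk>
      \<Longrightarrow> size S \<le> size T"
    and d: "0 < d" "d' dvd d" "1 < d'"
  shows "size (order_part G S d) < eta G d' d"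
proof (rule ccontr)
  assume "\<not> size (order_part G S d) < eta G d' d"
  moreover have "set_mset (order_part G S d) \<subseteq> torsion G d"
    using S(1) by (auto simp: order_part_def torsion_def)
  ultimately obtain T where T: "T \<subseteq># order_part G S d" "T \<noteq> {#}" "size T \<le> d'"
      "seq_sum G T \<in> torsion G (d div d')"
    using etaD[of d' d "order_part G S d"] d by auto
  let ?g = "seq_sum G T" and ?S' = "add_mset (seq_sum G T) (S - T)"
  have TS: "T \<subseteq># S"
    using T(1) by (metis order_part_def multiset_filter_subset subset_mset.order_trans)
  have ordT: "ord h = d" if "h \<in># T" for h
    using mset_subset_eqD[OF T(1) that] by (simp add: order_part_def)
  have g: "?g \<in> carrier G" "?g [^] (d div d') = \<one>"
    using T(4) by (auto simp: torsion_def)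
  have quot: "0 < d div d'" "d div d' < d"
    using d dvd_imp_le[of d' d] by (auto simp: div_greater_zero_iff)
  have ord_g: "ord ?g \<le> d div d'" "0 < ord ?g"
    using g quot(1) pow_eq_id dvd_imp_le ord_ge_1[OF fin g(1)] by auto
  have "cross_number G T = real (size T) / real d"
    using ordT by (rule cross_number_const_ord)
  also have "\<dots> \<le> real d' / real d"
    using T(3) by (simp add: divide_right_mono)
  \<comment> \<open>The quotient is exact because \<open>d'\<close> divides
    \<open>d\<close>.\<close>
  also have "\<dots> = 1 / real (d div d')"
    using d by (simp add: real_of_nat_div)
  also have "\<dots> \<le> 1 / real (ord ?g)"
    using ord_g quot by (simp add: frac_le)
  finally have le: "cross_number G T \<le> 1 / real (ord ?g)" .
  have S': "set_mset ?S' \<subseteq> carrier G" "tiny_free G ?S'"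
    using S(1) g(1) tiny_free_contract[OF S(1,2) TS T(2) le] by (auto dest: in_diffD)
  have "cross_number G ?S' = 1 / real (ord ?g) + cross_number G (S - T)"
    using cross_number_union[of G "{#?g#}" "S - T"] by (simp add: cross_number_single)
  moreover have "cross_number G S = cross_number G (S - T) + cross_number G T"
    using TS cross_number_union[of G "S - T" T] by simp
  \<comment> \<open>The exchange does not lower the cross number, and \<open>rho G\<close> is an
    upper bound, so equality holds and minimality of \<open>S\<close> applies to
    \<open>?S'\<close>.\<close>
  ultimately have "cross_number G ?S' = rho G"
    using le cross_number_le_rho[OF S'] S(3) by linarith
  then have "size S \<le> size (S - T) + 1"
    using minimal[OF S'] by simp
  then have "size T \<le> 1"
    using TS size_mset_mono[OF TS] by (simp add: size_Diff_submset)
  then have "size T = 1"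
    using T(2) by (metis le_neq_implies_less less_one size_eq_0_iff_empty)
  then obtain h where h: "T = {#h#}"
    by (metis size_1_singleton_mset)
  then have "?g = h"
    using mset_subset_eqD[OF TS] S(1) by (auto simp: seq_sum_single)
  \<comment> \<open>The single element \<open>h\<close> has order \<open>d\<close>, but as the sum
    of \<open>T\<close> its order is at most \<open>d div d' < d\<close>.\<close>
  then show False
    using ordT[of h] h ord_g(1) quot(2) by simp
qed

end

theorem theorem7:
  fixes G :: "('a, 'b) monoid_scheme" and S :: "'a multiset" and n :: nat and x :: "nat \<Rightarrow> nat"
  assumes "comm_group G" and "finite (carrier G)" and "group_exp G = n"
    and "set_mset S \<subseteq> carrier G" and "tiny_free G S" and "cross_number G S = rho G"
    and "\<And>T. \<lbrakk>set_mset T \<subseteq> carrier G; tiny_free G T; cross_number G T = rho G\<rbrakk> \<Longrightarrow> size S \<le> size T"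
    and "x = (\<lambda>d\<in>{d. d dvd n}. size (order_part G S d))"
  shows "(\<forall>d d'. d dvd n \<longrightarrow> d' dvd d \<longrightarrow> 1 < d' \<longrightarrow> int (x d) \<le> int (eta G d' d) - 1)
    \<and> x \<in> constraint_set G"
proof -
  interpret finite_comm_group G
    using assms(1,2) by (simp add: finite_comm_group_def finite_comm_group_axioms_def)
  have pos: "0 < d" if "d dvd n" for d
    using that group_exp_pos assms(3) dvd_pos_nat by blast
  have less: "x d < eta G d' d" if "d dvd n" "d' dvd d" "1 < d'" for d d'
  proof -
    have "size (order_part G S d) < eta G d' d"
      by (rule order_part_less_eta[OF assms(4-6) _ pos[OF that(1)] that(2,3)]) (rule assms(7))
    then show ?thesis
      using that(1) assms(8) by simp
  qed
  \<comment> \<open>The lower-bound property of the infimum also covers \<open>d = 1\<close>, where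
    the index set is empty.\<close>
  have "0 \<le> constraint G d x" if "d dvd n" for d
    unfolding constraint_def
  proof (rule INF_greatest)
    fix d' assume d': "d' \<in> {d'. d' dvd d} - {1}"
    then have "1 < d'"
      using pos[OF that] by (cases "d' = 0") auto
    then have "x d < eta G d' d"
      using less that d' by simp
    then show "0 \<le> ereal (real (eta G d' d) - 1 - real (x d))"
      by simp
  qed
  then have "x \<in> constraint_set G"
    using assms(3,8) by (simp add: constraint_set_def)
  moreover have "int (x d) \<le> int (eta G d' d) - 1" if "d dvd n" "d' dvd d" "1 < d'" for d d'
    using less[OF that] by simp
  ultimately show ?thesis by blast
qed

end
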